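(* FCFS is $O(\sqrt P)$-competitive for minimizing the $\ell_2$ norm of flow time: there is an absolute constant $C$ such that every instance satisfies $\sqrt{F(\mathcal{FCFS})}\le C\sqrt{P}\,\sqrt{F(\mathcal{OPT})}$.
   Context: A single machine and $n$ jobs; job $J_i$ has integer release time $r_i\ge0$ and integer processing time $p_i\ge1$. Unit slots $[t]=[t,t+1)$; a (preemptive) schedule assigns each slot to at most one job so that $J_i$ receives exactly $p_i$ slots, all with $t\ge r_i$. $c_i(\mathcal{S})$ is the completion time of $J_i$, $f_i(\mathcal{S})=c_i(\mathcal{S})-r_i$, $F(\mathcal{S})=\sum_i f_i(\mathcal{S})^2$, the $\ell_2$ norm of flow time is $\sqrt{F(\mathcal{S})}$, and $\mathcal{OPT}$ minimizes $F$. $P=\max_i p_i/\min_i p_i$. $\mathcal{FCFS}$ is the First-Come-First-Served schedule: jobs are processed non-preemptively in order of non-decreasing release time, never idling while some released job is unfinished. *)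

theory Defs
  imports Complex_Main
begin

text \<open>
  An instance consists of jobs \<open>0, \<dots>, n - 1\<close> with release times \<open>r\<close> and processing times \<open>p\<close>.
  A schedule maps the unit slot \<open>[t, t + 1)\<close> to the job processed in it, or to \<open>None\<close> if the
  machine idles.
\<close>

definition is_instance :: "nat \<Rightarrow> (nat \<Rightarrow> nat) \<Rightarrow> (nat \<Rightarrow> nat) \<Rightarrow> bool" where
  "is_instance n r p \<longleftrightarrow> n \<ge> 1 \<and> (\<forall>i<n. p i \<ge> 1)"

type_synonym schedule = "nat \<Rightarrow> nat option"

definition slots :: "schedule \<Rightarrow> nat \<Rightarrow> nat set" where
  "slots S i = {t. S t = Some i}"

definition is_schedule :: "nat \<Rightarrow> (nat \<Rightarrow> nat) \<Rightarrow> (nat \<Rightarrow> nat) \<Rightarrow> schedule \<Rightarrow> bool" where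
  "is_schedule n r p S \<longleftrightarrow>
     (\<forall>t i. S t = Some i \<longrightarrow> i < n \<and> r i \<le> t) \<and>
     (\<forall>i<n. card (slots S i) = p i)"

text \<open>
  The last slot \<open>t\<close> of a job ends at time \<open>t + 1\<close>. In a schedule of an instance, \<open>slots S i\<close> has
  \<open>p i \<ge> 1\<close> elements, so it is finite and nonempty and \<open>Max\<close> is meaningful.
\<close>

definition completion :: "schedule \<Rightarrow> nat \<Rightarrow> nat" where
  "completion S i = Max (slots S i) + 1"

definition flow_time :: "(nat \<Rightarrow> nat) \<Rightarrow> schedule \<Rightarrow> nat \<Rightarrow> real" where
  "flow_time r S i = real (completion S i) - real (r i)"

definition sq_flow :: "nat \<Rightarrow> (nat \<Rightarrow> nat) \<Rightarrow> schedule \<Rightarrow> real" where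
  "sq_flow n r S = (\<Sum>i<n. (flow_time r S i)\<^sup>2)"

definition is_OPT :: "nat \<Rightarrow> (nat \<Rightarrow> nat) \<Rightarrow> (nat \<Rightarrow> nat) \<Rightarrow> schedule \<Rightarrow> bool" where
  "is_OPT n r p S \<longleftrightarrow> is_arg_min (sq_flow n r) (is_schedule n r p) S"

definition size_ratio :: "nat \<Rightarrow> (nat \<Rightarrow> nat) \<Rightarrow> real" where
  "size_ratio n p = real (Max (p ` {..<n})) / real (Min (p ` {..<n}))"

text \<open>
  The three conditions are: no preemption, processing in order of release times, and no idling
  while a released job is unfinished. Jobs with equal release times may be processed in any
  relative order, so an instance can have several FCFS schedules.
\<close>

definition is_FCFS :: "nat \<Rightarrow> (nat \<Rightarrow> nat) \<Rightarrow> (nat \<Rightarrow> nat) \<Rightarrow> schedule \<Rightarrow> bool" where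
  "is_FCFS n r p S \<longleftrightarrow> is_schedule n r p S \<and>
     (\<forall>i<n. \<exists>s. slots S i = {s..<s + p i}) \<and>
     (\<forall>i<n. \<forall>j<n. r i < r j \<longrightarrow> (\<forall>t\<in>slots S i. \<forall>u\<in>slots S j. t < u)) \<and>
     (\<forall>t. S t = None \<longrightarrow> \<not> (\<exists>i<n. r i \<le> t \<and> t < completion S i))"

text \<open>Every instance has an FCFS schedule and an optimal schedule.\<close>

lemma FCFS_on_subset_exists:
  assumes "finite A" "\<And>i. i \<in> A \<Longrightarrow> p i \<ge> (1::nat)"
  shows "\<exists>S s. (\<forall>t i. S t = Some i \<longrightarrow> i \<in> A \<and> (r i :: nat) \<le> t) \<and>
     (\<forall>i\<in>A. slots S i = {s i..<s i + p i}) \<and>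
     (\<forall>i\<in>A. \<forall>j\<in>A. r i < r j \<longrightarrow> s i + p i \<le> s j) \<and>
     (\<forall>t. S t = None \<longrightarrow> \<not> (\<exists>i\<in>A. r i \<le> t \<and> t < s i + p i))"
  using assms
proof (induction "card A" arbitrary: A)
  case 0
  then show ?case by (intro exI[of _ "\<lambda>_. None"]) auto
next
  case (Suc k)
  have ne: "A \<noteq> {}" using Suc.hyps by auto
  have "Max (r ` A) \<in> r ` A" using Suc.prems ne by (intro Max_in) auto
  then obtain j where j: "j \<in> A" "r j = Max (r ` A)" by auto
  have jmax: "r i \<le> r j" if "i \<in> A" for i using that j Suc.prems by auto
  define B where "B = A - {j}"
  have AB: "A = insert j B" and jB: "j \<notin> B" and finB: "finite B"
    using j Suc.prems by (auto simp: B_def)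
  have "k = card B" using Suc.hyps AB jB finB by auto
  have "\<exists>S s. (\<forall>t i. S t = Some i \<longrightarrow> i \<in> B \<and> r i \<le> t) \<and>
     (\<forall>i\<in>B. slots S i = {s i..<s i + p i}) \<and>
     (\<forall>i\<in>B. \<forall>l\<in>B. r i < r l \<longrightarrow> s i + p i \<le> s l) \<and>
     (\<forall>t. S t = None \<longrightarrow> \<not> (\<exists>i\<in>B. r i \<le> t \<and> t < s i + p i))"
    using Suc.hyps(1)[OF \<open>k = card B\<close> finB] Suc.prems(2) AB by simp
  then obtain S s where H: "(\<forall>t i. S t = Some i \<longrightarrow> i \<in> B \<and> r i \<le> t) \<and>
     (\<forall>i\<in>B. slots S i = {s i..<s i + p i}) \<and>
     (\<forall>i\<in>B. \<forall>l\<in>B. r i < r l \<longrightarrow> s i + p i \<le> s l) \<and>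
     (\<forall>t. S t = None \<longrightarrow> \<not> (\<exists>i\<in>B. r i \<le> t \<and> t < s i + p i))"
    by (elim exE)
  have S1: "\<And>t i. S t = Some i \<Longrightarrow> i \<in> B \<and> r i \<le> t" using H by simp
  have S2: "\<And>i. i \<in> B \<Longrightarrow> slots S i = {s i..<s i + p i}" using H by simp
  have S3: "\<And>i l. i \<in> B \<Longrightarrow> l \<in> B \<Longrightarrow> r i < r l \<Longrightarrow> s i + p i \<le> s l" using H by simp
  have S4: "\<And>t i. S t = None \<Longrightarrow> i \<in> B \<Longrightarrow> r i \<le> t \<Longrightarrow> \<not> t < s i + p i"
    using H by blast
  define M where "M = Max (insert (r j) ((\<lambda>i. s i + p i) ` B))"
  have Mr: "r j \<le> M" and Ms: "\<And>i. i \<in> B \<Longrightarrow> s i + p i \<le> M"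
    using finB by (auto simp: M_def)
  have "M \<in> insert (r j) ((\<lambda>i. s i + p i) ` B)"
    unfolding M_def using finB by (intro Max_in) auto
  then have Mc: "M = r j \<or> (\<exists>i\<in>B. M = s i + p i)" by auto
  define S' where "S' = (\<lambda>t. if M \<le> t \<and> t < M + p j then Some j else S t)"
  define s' where "s' = s(j := M)"
  have free: "S t = None" if "M \<le> t" for t
  proof (rule ccontr)
    assume "S t \<noteq> None"
    then obtain i where i: "S t = Some i" by auto
    then have "i \<in> B" "t \<in> slots S i" using S1 by (auto simp: slots_def)
    then show False using S2 Ms[of i] that by auto
  qed
  have notj: "S t \<noteq> Some j" for t using S1 jB by blast
  have T1: "\<forall>t i. S' t = Some i \<longrightarrow> i \<in> A \<and> r i \<le> t"
    using S1 Mr AB by (auto simp: S'_def)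
  have "slots S' j = {M..<M + p j}" using notj by (auto simp: S'_def slots_def)
  moreover have "slots S' i = slots S i" if "i \<in> B" for i
    using free that jB by (auto simp: S'_def slots_def)
  ultimately have T2: "\<forall>i\<in>A. slots S' i = {s' i..<s' i + p i}"
    using S2 AB jB by (auto simp: s'_def)
  have T3: "\<forall>i\<in>A. \<forall>l\<in>A. r i < r l \<longrightarrow> s' i + p i \<le> s' l"
    using S3 Ms AB jB jmax by (auto simp: s'_def not_less[symmetric])
  have T4: "\<not> (\<exists>i\<in>A. r i \<le> t \<and> t < s' i + p i)" if "S' t = None" for t
  proof
    assume "\<exists>i\<in>A. r i \<le> t \<and> t < s' i + p i"
    then obtain i where i: "i \<in> A" "r i \<le> t" "t < s' i + p i" by blast
    have n: "S t = None" "\<not> (M \<le> t \<and> t < M + p j)"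
      using that by (auto simp: S'_def split: if_splits)
    show False
    proof (cases "i = j")
      case True
      then have "t < M" "r j \<le> t" using i n by (auto simp: s'_def)
      then obtain l where "l \<in> B" "M = s l + p l" using Mc by auto
      then show False
        using S4[OF n(1), of l] jmax[of l] AB \<open>t < M\<close> \<open>r j \<le> t\<close> by auto
    next
      case False
      then show False using S4[OF n(1), of i] i AB by (auto simp: s'_def)
    qed
  qed
  show ?case using T1 T2 T3 T4 by blast
qed

lemma FCFS_exists:
  assumes "is_instance n r p"
  shows "\<exists>S. is_FCFS n r p S"
proof -
  have p: "p i \<ge> 1" if "i < n" for i using assms that by (auto simp: is_instance_def)
  have "\<exists>S s. (\<forall>t i. S t = Some i \<longrightarrow> i \<in> {..<n} \<and> r i \<le> t) \<and>
     (\<forall>i\<in>{..<n}. slots S i = {s i..<s i + p i}) \<and>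
     (\<forall>i\<in>{..<n}. \<forall>j\<in>{..<n}. r i < r j \<longrightarrow> s i + p i \<le> s j) \<and>
     (\<forall>t. S t = None \<longrightarrow> \<not> (\<exists>i\<in>{..<n}. r i \<le> t \<and> t < s i + p i))"
    by (rule FCFS_on_subset_exists) (use p in simp_all)
  then obtain S s where H: "(\<forall>t i. S t = Some i \<longrightarrow> i \<in> {..<n} \<and> r i \<le> t) \<and>
     (\<forall>i\<in>{..<n}. slots S i = {s i..<s i + p i}) \<and>
     (\<forall>i\<in>{..<n}. \<forall>j\<in>{..<n}. r i < r j \<longrightarrow> s i + p i \<le> s j) \<and>
     (\<forall>t. S t = None \<longrightarrow> \<not> (\<exists>i\<in>{..<n}. r i \<le> t \<and> t < s i + p i))"
    by (elim exE)
  have S1: "\<And>t i. S t = Some i \<Longrightarrow> i < n \<and> r i \<le> t" using H by simp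
  have S2: "\<And>i. i < n \<Longrightarrow> slots S i = {s i..<s i + p i}" using H by simp
  have S3: "\<And>i j. i < n \<Longrightarrow> j < n \<Longrightarrow> r i < r j \<Longrightarrow> s i + p i \<le> s j" using H by simp
  have S4: "\<And>t i. S t = None \<Longrightarrow> i < n \<Longrightarrow> r i \<le> t \<Longrightarrow> \<not> t < s i + p i"
    using H by blast
  have c: "completion S i = s i + p i" if "i < n" for i
  proof -
    have "Max {s i..<s i + p i} = s i + p i - 1"
      using p[OF that] by (intro Max_eqI) auto
    then show ?thesis using S2[OF that] p[OF that] by (simp add: completion_def)
  qed
  have "is_FCFS n r p S"
    unfolding is_FCFS_def is_schedule_def
  proof (intro conjI allI impI ballI)
    fix i j t u
    assume *: "i < n" "j < n" "r i < r j" "t \<in> slots S i" "u \<in> slots S j"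
    then show "t < u" using S2[of i] S2[of j] S3[of i j] by auto
  next
    fix t assume "S t = None"
    then show "\<not> (\<exists>i<n. r i \<le> t \<and> t < completion S i)" using S4 c by auto
  qed (use S1 S2 in auto)
  then show ?thesis by blast
qed

lemma OPT_exists:
  assumes "is_instance n r p"
  shows "\<exists>S. is_OPT n r p S"
proof -
  define F where "F S = (\<Sum>i<n. (int (completion S i) - int (r i))\<^sup>2)" for S
  have F: "sq_flow n r S = of_int (F S)" for S
    by (simp add: sq_flow_def flow_time_def F_def)
  have nonneg: "F S \<ge> 0" for S unfolding F_def by (intro sum_nonneg) auto
  obtain S0 where "is_schedule n r p S0"
    using FCFS_exists[OF assms] by (auto simp: is_FCFS_def)
  from ex_has_least_nat[of "is_schedule n r p", OF this, of "\<lambda>S. nat (F S)"]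
  obtain S where "is_schedule n r p S"
    "\<And>T. is_schedule n r p T \<Longrightarrow> nat (F S) \<le> nat (F T)" by blast
  then have "is_OPT n r p S"
    using nonneg by (auto simp: is_OPT_def is_arg_min_def F not_less nat_le_eq_zle)
  then show ?thesis by blast
qed

end

theory Submission imports Defs begin

text \<open>
  Charge the squared age \<open>(t + 1 - r i)\<^sup>2\<close> to every slot \<open>t\<close> in which job \<open>i\<close> runs. FCFS minimizes
  the total charge: for \<open>a \<le> b\<close> the work released by time \<open>a\<close> and left at time \<open>b\<close> is smallest
  under FCFS, and the squared age of a slot counts the pairs \<open>(s, u)\<close> with
  \<open>r i \<le> min s u\<close> and \<open>max s u \<le> t\<close>. In any schedule job \<open>i\<close> is charged at most \<open>p i\<close> times its
  squared flow time, and under FCFS, where its slots are consecutive, at least a quarter of that.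
\<close>

text \<open>The slots spent on jobs released by time \<open>a\<close>, over the whole schedule.
  Intersecting with \<open>{..<b}\<close> or \<open>{b..}\<close> gives the work on these jobs done
  before time \<open>b\<close> or left at time \<open>b\<close>.\<close>

definition work_slots :: "(nat \<Rightarrow> nat) \<Rightarrow> schedule \<Rightarrow> nat \<Rightarrow> nat set" where
  "work_slots r S a = {t. \<exists>i. S t = Some i \<and> r i \<le> a}"

text \<open>Natural-valued, so that the squared ages can be counted as cardinalities. The truncated
  subtraction is harmless: in a schedule every slot \<open>t\<close> of job \<open>i\<close>
  satisfies \<open>r i \<le> t\<close>.\<close>

definition total_charge :: "nat \<Rightarrow> (nat \<Rightarrow> nat) \<Rightarrow> schedule \<Rightarrow> nat" where
  "total_charge n r S = (\<Sum>i<n. \<Sum>t\<in>slots S i. (t + 1 - r i)\<^sup>2)"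

lemma finite_slots:
  assumes "is_instance n r p" "is_schedule n r p S" "i < n"
  shows "finite (slots S i)"
  using assms by (intro card_ge_0_finite) (force simp: is_schedule_def is_instance_def)

lemma slots_disjoint: "i \<noteq> j \<Longrightarrow> slots S i \<inter> slots S j = {}"
  by (auto simp: slots_def)

lemma card_UN_slots:
  assumes "is_instance n r p" "is_schedule n r p S" "K \<subseteq> {..<n}"
  shows "card (\<Union>i\<in>K. slots S i) = (\<Sum>i\<in>K. p i)"
proof -
  have "card (\<Union>i\<in>K. slots S i) = (\<Sum>i\<in>K. card (slots S i))"
    using assms finite_slots[OF assms(1,2)] slots_disjoint[of _ _ S]
    by (intro card_UN_disjoint) (auto intro: finite_subset)
  also have "\<dots> = (\<Sum>i\<in>K. p i)"
    using assms by (intro sum.cong) (auto simp: is_schedule_def)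
  finally show ?thesis .
qed

lemma work_slots_eq_UN:
  assumes "is_schedule n r p S"
  shows "work_slots r S a = (\<Union>i\<in>{i. i < n \<and> r i \<le> a}. slots S i)"
  using assms by (auto simp: work_slots_def slots_def is_schedule_def)

lemma finite_work_slots:
  assumes "is_instance n r p" "is_schedule n r p S"
  shows "finite (work_slots r S a)"
  using finite_slots[OF assms] by (auto simp: work_slots_eq_UN[OF assms(2)])

lemma card_work_slots:
  assumes "is_instance n r p" "is_schedule n r p S"
  shows "card (work_slots r S a) = (\<Sum>i | i < n \<and> r i \<le> a. p i)"
  unfolding work_slots_eq_UN[OF assms(2)] using assms by (intro card_UN_slots) auto

text \<open>Before time \<open>b\<close>, \<open>T\<close> can only have worked on jobs released
  before \<open>b\<close>. Those among them with release time at most \<open>a\<close> are already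
  complete in \<open>S\<close>, and a job receives equally many slots in every schedule.\<close>

lemma done_work_le_of_finished:
  assumes "is_instance n r p" "is_schedule n r p S" "is_schedule n r p T"
    and fin: "\<And>i. i < n \<Longrightarrow> r i \<le> a \<Longrightarrow> r i < b \<Longrightarrow> slots S i \<subseteq> {..<b}"
  shows "card (work_slots r T a \<inter> {..<b}) \<le> card (work_slots r S a \<inter> {..<b})"
proof -
  define K where "K = {i. i < n \<and> r i \<le> a \<and> r i < b}"
  have K: "K \<subseteq> {..<n}" by (auto simp: K_def)
  have finU: "finite (\<Union>i\<in>K. slots T i)"
    using K finite_slots[OF assms(1,3)] by (auto intro: finite_subset)
  have "work_slots r T a \<inter> {..<b} \<subseteq> (\<Union>i\<in>K. slots T i)"
    using assms(3) by (force simp: work_slots_def slots_def is_schedule_def K_def)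
  then have "card (work_slots r T a \<inter> {..<b}) \<le> card (\<Union>i\<in>K. slots T i)"
    using finU by (rule card_mono[rotated])
  also have "\<dots> = card (\<Union>i\<in>K. slots S i)"
    using card_UN_slots[OF assms(1,2) K] card_UN_slots[OF assms(1,3) K] by simp
  also have "\<dots> \<le> card (work_slots r S a \<inter> {..<b})"
  proof (rule card_mono)
    show "(\<Union>i\<in>K. slots S i) \<subseteq> work_slots r S a \<inter> {..<b}"
      using fin by (auto simp: K_def work_slots_def slots_def)
  qed simp
  finally show ?thesis .
qed

text \<open>Induction on \<open>b\<close>, by what FCFS does in slot \<open>b\<close>. If it works
  on a job released by \<open>a\<close>, it gains one unit and \<open>T\<close> at most one.
  Otherwise the jobs released by both \<open>a\<close> and \<open>b\<close> are finished, and the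
  previous lemma applies at \<open>Suc b\<close>.\<close>

lemma FCFS_done_work_ge:
  assumes inst: "is_instance n r p" and S: "is_FCFS n r p S" and T: "is_schedule n r p T"
  shows "card (work_slots r T a \<inter> {..<b}) \<le> card (work_slots r S a \<inter> {..<b})"
proof (induction b)
  case (Suc b)
  have sched: "is_schedule n r p S" using S by (simp add: is_FCFS_def)
  consider (work) "b \<in> work_slots r S a" | (late) j where "S b = Some j" "a < r j"
    | (idle) "S b = None"
    by (cases "S b") (force simp: work_slots_def)+
  then show ?case
  proof cases
    case work
    have "card (work_slots r T a \<inter> {..<Suc b}) \<le> Suc (card (work_slots r T a \<inter> {..<b}))"
      by (simp add: lessThan_Suc Int_insert_right card_insert_if)
    also have "\<dots> \<le> Suc (card (work_slots r S a \<inter> {..<b}))" using Suc by simp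
    also have "\<dots> = card (work_slots r S a \<inter> {..<Suc b})"
      using work by (simp add: lessThan_Suc Int_insert_right)
    finally show ?thesis .
  next
    case late
    show ?thesis
    proof (rule done_work_le_of_finished[OF inst sched T])
      fix i assume i: "i < n" "r i \<le> a"
      \<comment> \<open>Job \<open>j\<close>, running in slot \<open>b\<close>, is released strictly
        after \<open>i\<close>, so the FCFS order puts all of \<open>i\<close> before slot
        \<open>b\<close>.\<close>
      have "j < n" "b \<in> slots S j" "r i < r j"
        using late i sched by (auto simp: is_schedule_def slots_def)
      then have "\<forall>t\<in>slots S i. t < b" using S i unfolding is_FCFS_def by blast
      then show "slots S i \<subseteq> {..<Suc b}" by auto
    qed
  next
    case idle
    show ?thesis
    proof (rule done_work_le_of_finished[OF inst sched T])
      fix i assume i: "i < n" "r i < Suc b"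
      \<comment> \<open>Job \<open>i\<close> is released by time \<open>b\<close> and slot
        \<open>b\<close> idles, so the no-idling condition says that \<open>i\<close> is
        complete.\<close>
      then have "completion S i \<le> b"
        using S idle unfolding is_FCFS_def less_Suc_eq_le by (metis not_less)
      moreover have "t \<le> Max (slots S i)" if "t \<in> slots S i" for t
        using finite_slots[OF inst sched i(1)] that by simp
      ultimately show "slots S i \<subseteq> {..<Suc b}" unfolding completion_def by fastforce
    qed
  qed
qed simp

text \<open>Jobs released by \<open>a\<close> have the same total work in all schedules, so more
  work done before \<open>b\<close> means less work left.\<close>

lemma FCFS_remaining_work_le:
  assumes inst: "is_instance n r p" and S: "is_FCFS n r p S" and T: "is_schedule n r p T"
  shows "card (work_slots r S a \<inter> {b..}) \<le> card (work_slots r T a \<inter> {b..})"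
proof -
  have split: "card (work_slots r U a \<inter> {..<b}) + card (work_slots r U a \<inter> {b..}) =
      (\<Sum>i | i < n \<and> r i \<le> a. p i)" if "is_schedule n r p U" for U
  proof -
    have "card (work_slots r U a) =
        card (work_slots r U a \<inter> {..<b} \<union> work_slots r U a \<inter> {b..})"
      by (rule arg_cong[where f = card]) auto
    also have "\<dots> = card (work_slots r U a \<inter> {..<b}) + card (work_slots r U a \<inter> {b..})"
      using finite_work_slots[OF inst that] by (intro card_Un_disjoint) auto
    finally show ?thesis using card_work_slots[OF inst that] by simp
  qed
  have "is_schedule n r p S" using S by (simp add: is_FCFS_def)
  then show ?thesis using split[of S] split[OF T] FCFS_done_work_ge[OF assms, of a b] by linarith
qed

text \<open>Double counting: write each squared age as a number of pairs \<open>(s, u)\<close>, then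
  sum over the pairs first. The horizon \<open>H\<close> keeps the set of pairs finite.\<close>

lemma total_charge_eq_remaining_work:
  assumes inst: "is_instance n r p" and S: "is_schedule n r p S"
    and H: "\<And>i. i < n \<Longrightarrow> slots S i \<subseteq> {..<H}"
  shows "total_charge n r S =
    (\<Sum>(s, u)\<in>{..<H} \<times> {..<H}. card (work_slots r S (min s u) \<inter> {max s u..}))"
proof -
  let ?ok = "\<lambda>i t (s, u). r i \<le> min s u \<and> max s u \<le> (t::nat)"
  \<comment> \<open>The age \<open>t + 1 - r i\<close> is the number of time points in
    \<open>{r i..t}\<close>, so its square counts the pairs from this interval, all of which lie
    below \<open>H\<close>.\<close>
  have sq: "(t + 1 - r i)\<^sup>2 = (\<Sum>z\<in>{..<H} \<times> {..<H}. of_bool (?ok i t z))"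
    if "i < n" "t \<in> slots S i" for i t
  proof -
    have "t < H" using H that by auto
    then have "({..<H} \<times> {..<H}) \<inter> {z. ?ok i t z} = {r i..t} \<times> {r i..t}" by auto
    then have "(\<Sum>z\<in>{..<H} \<times> {..<H}. of_bool (?ok i t z)) = card ({r i..t} \<times> {r i..t})"
      by (simp add: sum_of_bool_eq)
    then show ?thesis by (simp add: card_cartesian_product power2_eq_square)
  qed
  \<comment> \<open>For a fixed pair, the slots counted are exactly the work released by
    \<open>min s u\<close> and left at \<open>max s u\<close>.\<close>
  have rem: "(\<Sum>i<n. \<Sum>t\<in>slots S i. of_bool (?ok i t (s, u))) =
      card (work_slots r S (min s u) \<inter> {max s u..})" for s u
  proof -
    have "(\<Sum>i<n. \<Sum>t\<in>slots S i. of_bool (?ok i t (s, u))) =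
        (\<Sum>i<n. card {t \<in> slots S i. ?ok i t (s, u)})"
      using finite_slots[OF inst S]
      by (intro sum.cong) (auto simp: sum_of_bool_eq Int_def)
    also have "\<dots> = card (\<Union>i<n. {t \<in> slots S i. ?ok i t (s, u)})"
      using finite_slots[OF inst S] slots_disjoint[of _ _ S]
      by (intro card_UN_disjoint[symmetric]) auto
    also have "(\<Union>i<n. {t \<in> slots S i. ?ok i t (s, u)}) =
        work_slots r S (min s u) \<inter> {max s u..}"
      using S by (auto simp: work_slots_eq_UN)
    finally show ?thesis .
  qed
  have "total_charge n r S =
      (\<Sum>i<n. \<Sum>t\<in>slots S i. \<Sum>z\<in>{..<H} \<times> {..<H}. of_bool (?ok i t z))"
    using sq by (simp add: total_charge_def)
  also have "\<dots> = (\<Sum>z\<in>{..<H} \<times> {..<H}. \<Sum>i<n. \<Sum>t\<in>slots S i. of_bool (?ok i t z))"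
  proof -
    have "(\<Sum>t\<in>slots S i. \<Sum>z\<in>{..<H} \<times> {..<H}. of_bool (?ok i t z)) =
        (\<Sum>z\<in>{..<H} \<times> {..<H}. \<Sum>t\<in>slots S i. of_bool (?ok i t z))" for i
      by (rule sum.swap)
    from trans[OF sum.cong[OF refl this] sum.swap] show ?thesis .
  qed
  also have "\<dots> = (\<Sum>(s, u)\<in>{..<H} \<times> {..<H}. card (work_slots r S (min s u) \<inter> {max s u..}))"
    using rem by (intro sum.cong) auto
  finally show ?thesis .
qed

lemma slots_bounded:
  assumes "is_instance n r p" "is_schedule n r p S"
  shows "\<exists>H. \<forall>i<n. slots S i \<subseteq> {..<H}"
proof -
  have "finite (\<Union>i<n. slots S i)" using finite_slots[OF assms] by auto
  then obtain H where "\<forall>t\<in>(\<Union>i<n. slots S i). t < H"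
    using finite_nat_set_iff_bounded by blast
  then show ?thesis by (intro exI[of _ H]) auto
qed

lemma FCFS_total_charge_le:
  assumes inst: "is_instance n r p" and S: "is_FCFS n r p S" and T: "is_schedule n r p T"
  shows "total_charge n r S \<le> total_charge n r T"
proof -
  have sched: "is_schedule n r p S" using S by (simp add: is_FCFS_def)
  obtain H1 where H1: "\<And>i. i < n \<Longrightarrow> slots S i \<subseteq> {..<H1}" using slots_bounded[OF inst sched] by blast
  obtain H2 where H2: "\<And>i. i < n \<Longrightarrow> slots T i \<subseteq> {..<H2}" using slots_bounded[OF inst T] by blast
  \<comment> \<open>A common horizon lets both charges be sums over the same pairs, compared term by
    term.\<close>
  define H where "H = max H1 H2"
  have H: "slots S i \<subseteq> {..<H}" "slots T i \<subseteq> {..<H}" if "i < n" for i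
    using H1[OF that] H2[OF that] by (auto simp: H_def)
  have "total_charge n r S =
      (\<Sum>(s, u)\<in>{..<H} \<times> {..<H}. card (work_slots r S (min s u) \<inter> {max s u..}))"
    using H by (intro total_charge_eq_remaining_work[OF inst sched])
  also have "\<dots> \<le>
      (\<Sum>(s, u)\<in>{..<H} \<times> {..<H}. card (work_slots r T (min s u) \<inter> {max s u..}))"
    using FCFS_remaining_work_le[OF assms] by (intro sum_mono) auto
  also have "\<dots> = total_charge n r T"
    using H by (intro total_charge_eq_remaining_work[OF inst T, symmetric])
  finally show ?thesis .
qed

text \<open>Source of the factor 4: \<open>x\<close> stands for the waiting time before a job's
  first slot under FCFS, so \<open>x + p\<close> is its flow time and the summands are its squared
  ages.\<close>

lemma sum_consecutive_squares_ge:
  fixes x :: nat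
  shows "p * (x + p)\<^sup>2 \<le> 4 * (\<Sum>k<p. (x + k + 1)\<^sup>2)"
proof (induction p)
  case (Suc p)
  \<comment> \<open>With \<open>y = x + p\<close>, the left side of the claim grows by
    \<open>p * (2 * y + 1) + (y + 1)\<^sup>2\<close>, which is at most
    \<open>4 * (y + 1)\<^sup>2\<close> because \<open>p \<le> y\<close>.\<close>
  have "Suc p * (x + Suc p)\<^sup>2 \<le> p * (x + p)\<^sup>2 + 4 * (x + p + 1)\<^sup>2"
    by (simp add: power2_eq_square algebra_simps)
  with Suc show ?case by simp
qed simp

lemma total_charge_le:
  assumes inst: "is_instance n r p" and T: "is_schedule n r p T"
  shows "real (total_charge n r T) \<le> real (Max (p ` {..<n})) * sq_flow n r T"
proof -
  have "real (\<Sum>t\<in>slots T i. (t + 1 - r i)\<^sup>2) \<le> real (Max (p ` {..<n})) * (flow_time r T i)\<^sup>2"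
    if i: "i < n" for i
  proof -
    have fin: "finite (slots T i)" using finite_slots[OF inst T i] .
    \<comment> \<open>Age and completion time are both measured at the end \<open>t + 1\<close> of a
      slot, so the age in the last slot is exactly the flow time.\<close>
    have charge: "real ((t + 1 - r i)\<^sup>2) \<le> (flow_time r T i)\<^sup>2" if t: "t \<in> slots T i" for t
    proof -
      have "r i \<le> t" using t T by (auto simp: slots_def is_schedule_def)
      moreover have "t \<le> Max (slots T i)" using fin t by simp
      ultimately have "real (t + 1 - r i) \<le> flow_time r T i"
        by (simp add: flow_time_def completion_def of_nat_diff)
      then show ?thesis by (simp add: power_mono)
    qed
    have "real (\<Sum>t\<in>slots T i. (t + 1 - r i)\<^sup>2) = (\<Sum>t\<in>slots T i. real ((t + 1 - r i)\<^sup>2))"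
      by simp
    also have "\<dots> \<le> (\<Sum>t\<in>slots T i. (flow_time r T i)\<^sup>2)"
      using charge by (rule sum_mono)
    also have "\<dots> = real (p i) * (flow_time r T i)\<^sup>2"
      using T i by (simp add: is_schedule_def)
    also have "\<dots> \<le> real (Max (p ` {..<n})) * (flow_time r T i)\<^sup>2"
      using i by (intro mult_right_mono) auto
    finally show ?thesis .
  qed
  then show ?thesis
    unfolding total_charge_def sq_flow_def of_nat_sum[of _ "{..<n}"] sum_distrib_left
    by (intro sum_mono) auto
qed

lemma FCFS_total_charge_ge:
  assumes inst: "is_instance n r p" and S: "is_FCFS n r p S"
  shows "real (Min (p ` {..<n})) * sq_flow n r S \<le> 4 * real (total_charge n r S)"
proof -
  have "real (Min (p ` {..<n})) * (flow_time r S i)\<^sup>2 \<le>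
      4 * real (\<Sum>t\<in>slots S i. (t + 1 - r i)\<^sup>2)" if i: "i < n" for i
  proof -
    obtain s where s: "slots S i = {s..<s + p i}"
      using S i unfolding is_FCFS_def by blast
    have p: "p i \<ge> 1" using inst i by (auto simp: is_instance_def)
    have "s \<in> slots S i" using s p by simp
    then have "S s = Some i" by (simp add: slots_def)
    then have rs: "r i \<le> s" using S by (simp add: is_FCFS_def is_schedule_def)
    have "Max {s..<s + p i} = s + p i - 1" using p by (intro Max_eqI) auto
    then have flow: "flow_time r S i = real (s - r i + p i)"
      using s p rs by (simp add: flow_time_def completion_def of_nat_diff)
    \<comment> \<open>Without preemption the ages are consecutive integers, from
      \<open>s - r i + 1\<close> to the flow time \<open>s - r i + p i\<close>.\<close>
    have "(\<Sum>t\<in>slots S i. (t + 1 - r i)\<^sup>2) = (\<Sum>k<p i. (s - r i + k + 1)\<^sup>2)"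
      unfolding s by (rule sum.reindex_bij_witness[of _ "\<lambda>k. s + k" "\<lambda>t. t - s"]) (use rs in auto)
    then have le: "p i * (s - r i + p i)\<^sup>2 \<le> 4 * (\<Sum>t\<in>slots S i. (t + 1 - r i)\<^sup>2)"
      using sum_consecutive_squares_ge by simp
    have "real (Min (p ` {..<n})) * (flow_time r S i)\<^sup>2 \<le> real (p i) * (flow_time r S i)\<^sup>2"
      using i by (intro mult_right_mono) auto
    also have "\<dots> = real (p i * (s - r i + p i)\<^sup>2)" by (simp add: flow)
    also have "\<dots> \<le> real (4 * (\<Sum>t\<in>slots S i. (t + 1 - r i)\<^sup>2))"
      using le by (rule of_nat_mono)
    finally show ?thesis by simp
  qed
  then show ?thesis
    unfolding total_charge_def sq_flow_def of_nat_sum[of _ "{..<n}"] sum_distrib_left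
    by (intro sum_mono) auto
qed

text \<open>Pass from \<open>S\<close> to \<open>T\<close> through their total charges: the lower
  bound for FCFS costs the smallest processing time, the upper bound for \<open>T\<close> the
  largest, and dividing leaves their ratio.\<close>

lemma FCFS_sq_flow_le:
  assumes inst: "is_instance n r p" and S: "is_FCFS n r p S" and T: "is_schedule n r p T"
  shows "sq_flow n r S \<le> 4 * size_ratio n p * sq_flow n r T"
proof -
  have "n \<ge> 1" using inst by (simp add: is_instance_def)
  then have "Min (p ` {..<n}) \<in> p ` {..<n}" by (intro Min_in) (auto simp: lessThan_empty_iff)
  then have pos: "Min (p ` {..<n}) > 0" using inst by (fastforce simp: is_instance_def)
  have "real (Min (p ` {..<n})) * sq_flow n r S \<le> 4 * real (total_charge n r S)"
    by (rule FCFS_total_charge_ge[OF inst S])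
  also have "\<dots> \<le> 4 * real (total_charge n r T)"
    using FCFS_total_charge_le[OF assms] by simp
  also have "\<dots> \<le> 4 * (real (Max (p ` {..<n})) * sq_flow n r T)"
    using total_charge_le[OF inst T] by simp
  finally show ?thesis using pos by (simp add: size_ratio_def field_simps)
qed

theorem theoremE2:
  "\<exists>C::real. \<forall>n r p S T.
     is_instance n r p \<longrightarrow> is_FCFS n r p S \<longrightarrow> is_OPT n r p T \<longrightarrow>
       sqrt (sq_flow n r S) \<le> C * sqrt (size_ratio n p) * sqrt (sq_flow n r T)"
\<comment> \<open>The constant 2 is the square root of the factor 4 in the bound for squared flow
  times.\<close>
proof (intro exI[of _ 2] allI impI)
  fix n r p S T
  assume inst: "is_instance n r p" and S: "is_FCFS n r p S" and T: "is_OPT n r p T"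
  have "is_schedule n r p T" using T by (simp add: is_OPT_def is_arg_min_def)
  then have "sqrt (sq_flow n r S) \<le> sqrt (4 * size_ratio n p * sq_flow n r T)"
    using FCFS_sq_flow_le[OF inst S] by simp
  then show "sqrt (sq_flow n r S) \<le> 2 * sqrt (size_ratio n p) * sqrt (sq_flow n r T)"
    by (simp add: real_sqrt_mult)
qed

end
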